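(* Let $(W,S)$ be a finite Coxeter system, and let $C$ be an equivalence class of $\mathrm{Int}(W)$ under the descent-preserving equivalence relation $\stackrel{D}{\simeq}$. Then $\overline{\mathrm{min}}(C)$ and $\overline{\mathrm{max}}(C)$ are right weak Bruhat intervals in $(W,\leq_R)$.
   Context: For a Coxeter system $(W,S)$, $\ell$ is the length function with respect to $S$, and $\mathrm{Des}_L(w)=\{s\in S\mid \ell(sw)<\ell(w)\}$. The left weak Bruhat order is given by $u\leq_L v$ iff $\ell(v)=\ell(u)+\ell(vu^{-1})$; the right weak Bruhat order is given by $u\leq_R v$ iff $\ell(v)=\ell(u)+\ell(u^{-1}v)$. For $u\leq_L v$, $[u,v]_L=\{w\in W\mid u\leq_L w\leq_L v\}$, and $\mathrm{Int}(W)=\{[u,v]_L\mid u,v\in W,\ u\leq_L v\}$. A right weak Bruhat interval is a set of the form $[x,y]_R=\{w\in W\mid x\leq_R w\leq_R y\}$ with $x\leq_R y$. For $I_1,I_2\in\mathrm{Int}(W)$, write $I_1\stackrel{D}{\simeq}I_2$ if there is a poset isomorphism $f:(I_1,\leq_L)\to(I_2,\leq_L)$ with $\mathrm{Des}_L(w)=\mathrm{Des}_L(f(w))$ for all $w\in I_1$; this is an equivalence relation on $\mathrm{Int}(W)$. For an equivalence class $C$, $\overline{\mathrm{min}}(C)=\{u\mid[u,v]_L\in C\}$ and $\overline{\mathrm{max}}(C)=\{v\mid[u,v]_L\in C\}$ are the sets of minimum, respectively maximum, elements of the intervals in $C$. *)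

theory Defs
  imports "HOL-Algebra.Algebra"
begin

definition word_prod :: "('a, 'b) monoid_scheme \<Rightarrow> 'a list \<Rightarrow> 'a" where
  "word_prod W ws = foldr (\<otimes>\<^bsub>W\<^esub>) ws \<one>\<^bsub>W\<^esub>"

text \<open>
  The congruence on words over \<open>S\<close> (the free monoid on \<open>S\<close>) generated by the Coxeter relations
  \<open>(s t)^m = 1\<close>, where \<open>m\<close> is the order of \<open>s t\<close> in \<open>W\<close>. The library function \<open>group.ord\<close>
  returns 0 for elements of infinite order, in which case the relation is vacuous, as it should be.
  For \<open>s = t\<close> an involution, \<open>m = 1\<close> and the relation reads \<open>s s = 1\<close>; hence generators are
  their own formal inverses, and this monoid presentation is the usual group presentation.
\<close>
inductive coxeter_cong :: "('a, 'b) monoid_scheme \<Rightarrow> 'a set \<Rightarrow> 'a list \<Rightarrow> 'a list \<Rightarrow> bool"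
  for W S where
  refl: "us \<in> lists S \<Longrightarrow> coxeter_cong W S us us"
| sym: "coxeter_cong W S us vs \<Longrightarrow> coxeter_cong W S vs us"
| trans: "coxeter_cong W S us vs \<Longrightarrow> coxeter_cong W S vs ws \<Longrightarrow> coxeter_cong W S us ws"
| rel: "\<lbrakk>us \<in> lists S; vs \<in> lists S; s \<in> S; t \<in> S\<rbrakk> \<Longrightarrow>
    coxeter_cong W S (us @ concat (replicate (group.ord W (s \<otimes>\<^bsub>W\<^esub> t)) [s, t]) @ vs) (us @ vs)"

text \<open>
  \<open>W\<close> is generated by the set \<open>S\<close> of involutions, and \<open>S\<close> together with the relations above is
  a presentation of \<open>W\<close>.
\<close>
locale coxeter_system = group W for W :: "('a, 'b) monoid_scheme" (structure) +
  fixes S :: "'a set"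
  assumes gens_closed: "S \<subseteq> carrier W"
    and gens_involution: "\<And>s. s \<in> S \<Longrightarrow> ord s = 2"
    and gens_generate: "generate W S = carrier W"
    and presentation:
      "\<And>us vs. \<lbrakk>us \<in> lists S; vs \<in> lists S; word_prod W us = word_prod W vs\<rbrakk>
        \<Longrightarrow> coxeter_cong W S us vs"

definition cox_length :: "('a, 'b) monoid_scheme \<Rightarrow> 'a set \<Rightarrow> 'a \<Rightarrow> nat" where
  "cox_length W S w = (LEAST k. \<exists>ws \<in> lists S. length ws = k \<and> word_prod W ws = w)"

definition left_descents :: "('a, 'b) monoid_scheme \<Rightarrow> 'a set \<Rightarrow> 'a \<Rightarrow> 'a set" where
  "left_descents W S w = {s \<in> S. cox_length W S (s \<otimes>\<^bsub>W\<^esub> w) < cox_length W S w}"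

definition weak_le_L :: "('a, 'b) monoid_scheme \<Rightarrow> 'a set \<Rightarrow> 'a \<Rightarrow> 'a \<Rightarrow> bool" where
  "weak_le_L W S u v \<longleftrightarrow> u \<in> carrier W \<and> v \<in> carrier W \<and>
     cox_length W S v = cox_length W S u + cox_length W S (v \<otimes>\<^bsub>W\<^esub> inv\<^bsub>W\<^esub> u)"

definition weak_le_R :: "('a, 'b) monoid_scheme \<Rightarrow> 'a set \<Rightarrow> 'a \<Rightarrow> 'a \<Rightarrow> bool" where
  "weak_le_R W S u v \<longleftrightarrow> u \<in> carrier W \<and> v \<in> carrier W \<and>
     cox_length W S v = cox_length W S u + cox_length W S (inv\<^bsub>W\<^esub> u \<otimes>\<^bsub>W\<^esub> v)"

definition interval_L :: "('a, 'b) monoid_scheme \<Rightarrow> 'a set \<Rightarrow> 'a \<Rightarrow> 'a \<Rightarrow> 'a set" where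
  "interval_L W S u v = {w. weak_le_L W S u w \<and> weak_le_L W S w v}"

definition interval_R :: "('a, 'b) monoid_scheme \<Rightarrow> 'a set \<Rightarrow> 'a \<Rightarrow> 'a \<Rightarrow> 'a set" where
  "interval_R W S x y = {w. weak_le_R W S x w \<and> weak_le_R W S w y}"

definition left_intervals :: "('a, 'b) monoid_scheme \<Rightarrow> 'a set \<Rightarrow> 'a set set" where
  "left_intervals W S = {interval_L W S u v | u v. weak_le_L W S u v}"

definition right_intervals :: "('a, 'b) monoid_scheme \<Rightarrow> 'a set \<Rightarrow> 'a set set" where
  "right_intervals W S = {interval_R W S x y | x y. weak_le_R W S x y}"

definition descent_iso ::
    "('a, 'b) monoid_scheme \<Rightarrow> 'a set \<Rightarrow> 'a set \<Rightarrow> 'a set \<Rightarrow> ('a \<Rightarrow> 'a) \<Rightarrow> bool" where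
  "descent_iso W S I1 I2 f \<longleftrightarrow> bij_betw f I1 I2 \<and>
     (\<forall>x\<in>I1. \<forall>y\<in>I1. weak_le_L W S x y \<longleftrightarrow> weak_le_L W S (f x) (f y)) \<and>
     (\<forall>w\<in>I1. left_descents W S w = left_descents W S (f w))"

definition descent_equiv :: "('a, 'b) monoid_scheme \<Rightarrow> 'a set \<Rightarrow> ('a set \<times> 'a set) set" where
  "descent_equiv W S = {(I1, I2). I1 \<in> left_intervals W S \<and> I2 \<in> left_intervals W S \<and>
     (\<exists>f. descent_iso W S I1 I2 f)}"

definition min_elems :: "('a, 'b) monoid_scheme \<Rightarrow> 'a set \<Rightarrow> 'a set set \<Rightarrow> 'a set" where
  "min_elems W S C = {u. \<exists>v. weak_le_L W S u v \<and> interval_L W S u v \<in> C}"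

definition max_elems :: "('a, 'b) monoid_scheme \<Rightarrow> 'a set \<Rightarrow> 'a set set \<Rightarrow> 'a set" where
  "max_elems W S C = {v. \<exists>u. weak_le_L W S u v \<and> interval_L W S u v \<in> C}"

end

theory Submission
  imports Defs
begin

text \<open>
  A descent-preserving isomorphism also preserves the generators labelling the covers: two distinct
  left descents \<open>s, t\<close> of \<open>y\<close> satisfy \<open>t \<in> Des\<^sub>L(s y)\<close>, so a new descent at a cover determines its
  label. Hence the class of \<open>[u\<^sub>0, w u\<^sub>0]\<^sub>L\<close> consists of the intervals \<open>[u, w u]\<^sub>L\<close> with
  \<open>\<ell>(w u) = \<ell>(w) + \<ell>(u)\<close> and \<open>Des\<^sub>L(x u) = Des\<^sub>L(x u\<^sub>0)\<close> for all \<open>x \<le>\<^sub>L w\<close>. Each of these conditions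
  says that \<open>u\<close> lies above, or below, a fixed element for \<open>\<le>\<^sub>R\<close>, and the right weak order on a
  finite Coxeter group is a lattice, so the admissible \<open>u\<close> form an interval; left multiplication
  by \<open>w\<close> carries the minima to the maxima. The exchange property comes from the presentation, via the
  parity of the number of times a reflection occurs along a word.
\<close>

section \<open>Words in the generators and the length function\<close>

lemma word_prod_Nil [simp]: "word_prod W [] = \<one>\<^bsub>W\<^esub>"
  and word_prod_Cons [simp]: "word_prod W (s # ws) = s \<otimes>\<^bsub>W\<^esub> word_prod W ws"
  by (simp_all add: word_prod_def)

context coxeter_system
begin

abbreviation len :: "'a \<Rightarrow> nat" where "len \<equiv> cox_length W S"

abbreviation le_R :: "'a \<Rightarrow> 'a \<Rightarrow> bool" (infix "\<preceq>\<^sub>R" 50) where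
  "u \<preceq>\<^sub>R v \<equiv> weak_le_R W S u v"

abbreviation le_L :: "'a \<Rightarrow> 'a \<Rightarrow> bool" (infix "\<preceq>\<^sub>L" 50) where
  "u \<preceq>\<^sub>L v \<equiv> weak_le_L W S u v"

lemma gen_carrier [simp]: "s \<in> S \<Longrightarrow> s \<in> carrier W"
  using gens_closed by blast

lemma gen_square [simp]: "s \<in> S \<Longrightarrow> s \<otimes> s = \<one>"
  using pow_ord_eq_1[of s] gens_involution[of s] by (simp add: numeral_2_eq_2)

lemma gen_inv [simp]: "s \<in> S \<Longrightarrow> inv s = s"
  by (simp add: inv_equality)

lemma gen_cancel [simp]: "\<lbrakk>s \<in> S; x \<in> carrier W\<rbrakk> \<Longrightarrow> s \<otimes> (s \<otimes> x) = x"
  by (simp flip: m_assoc)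

lemma inv_cancel_left [simp]:
  "\<lbrakk>x \<in> carrier W; y \<in> carrier W\<rbrakk> \<Longrightarrow> inv x \<otimes> (x \<otimes> y) = y"
  "\<lbrakk>x \<in> carrier W; y \<in> carrier W\<rbrakk> \<Longrightarrow> x \<otimes> (inv x \<otimes> y) = y"
  by (simp_all flip: m_assoc)

lemma word_prod_closed [simp]: "ws \<in> lists S \<Longrightarrow> word_prod W ws \<in> carrier W"
  by (induction ws) auto

lemma word_prod_append:
  "\<lbrakk>us \<in> lists S; vs \<in> lists S\<rbrakk> \<Longrightarrow> word_prod W (us @ vs) = word_prod W us \<otimes> word_prod W vs"
  by (induction us) (auto simp: m_assoc)

lemma word_prod_rev: "ws \<in> lists S \<Longrightarrow> word_prod W (rev ws) = inv (word_prod W ws)"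
proof (induction ws)
  case (Cons s ws)
  then have "rev ws \<in> lists S" "[s] \<in> lists S" by auto
  with Cons show ?case by (auto simp: word_prod_append inv_mult_group)
qed simp

lemma ex_word:
  assumes "w \<in> carrier W"
  shows "\<exists>ws \<in> lists S. word_prod W ws = w"
proof -
  have "w \<in> generate W S" using assms gens_generate by simp
  then show ?thesis
  proof (induction w rule: generate.induct)
    case one
    show ?case by (rule bexI[of _ "[]"]) auto
  next
    case (incl s)
    then show ?case by (intro bexI[of _ "[s]"]) auto
  next
    case (inv s)
    then show ?case by (intro bexI[of _ "[s]"]) auto
  next
    case (eng a b)
    then obtain us vs where "us \<in> lists S" "vs \<in> lists S" "word_prod W us = a" "word_prod W vs = b"
      by blast
    then show ?case by (intro bexI[of _ "us @ vs"]) (auto simp: word_prod_append)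
  qed
qed

lemma ex_reduced_word:
  assumes "w \<in> carrier W"
  obtains ws where "ws \<in> lists S" "word_prod W ws = w" "length ws = len w"
proof -
  have "\<exists>k. \<exists>ws \<in> lists S. length ws = k \<and> word_prod W ws = w" using ex_word[OF assms] by blast
  from LeastI_ex[OF this] show ?thesis using that by (auto simp: cox_length_def)
qed

lemma len_word_le: "ws \<in> lists S \<Longrightarrow> len (word_prod W ws) \<le> length ws"
  unfolding cox_length_def by (rule Least_le) blast

lemma len_mult_le:
  assumes "x \<in> carrier W" "y \<in> carrier W"
  shows "len (x \<otimes> y) \<le> len x + len y"
proof -
  obtain us where us: "us \<in> lists S" "word_prod W us = x" "length us = len x"
    using assms(1) by (rule ex_reduced_word)
  obtain vs where vs: "vs \<in> lists S" "word_prod W vs = y" "length vs = len y"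
    using assms(2) by (rule ex_reduced_word)
  show ?thesis using len_word_le[of "us @ vs"] us vs by (auto simp: word_prod_append)
qed

lemma len_inv [simp]:
  assumes "x \<in> carrier W"
  shows "len (inv x) = len x"
proof -
  have le: "len (inv y) \<le> len y" if "y \<in> carrier W" for y
  proof -
    obtain us where us: "us \<in> lists S" "word_prod W us = y" "length us = len y"
      using \<open>y \<in> carrier W\<close> by (rule ex_reduced_word)
    moreover have "rev us \<in> lists S" using us by auto
    ultimately show ?thesis using len_word_le[of "rev us"] by (auto simp: word_prod_rev)
  qed
  show ?thesis using le[of x] le[of "inv x"] assms by simp
qed

lemma len_one [simp]: "len \<one> = 0"
  using len_word_le[of "[]"] by simp

lemma len_eq_0:
  assumes "x \<in> carrier W" "len x = 0"
  shows "x = \<one>"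
  by (rule ex_reduced_word[OF assms(1)]) (use assms(2) in auto)

lemma len_gen:
  assumes "s \<in> S"
  shows "len s = 1"
proof -
  have "s \<noteq> \<one>" using gens_involution[OF assms] by auto
  then have "len s \<noteq> 0" using len_eq_0 gen_carrier assms by blast
  then show ?thesis using len_word_le[of "[s]"] assms by auto
qed

section \<open>Reflection counts along words and the exchange property\<close>

text \<open>
  For a word \<open>s\<^sub>1 \<dots> s\<^sub>k\<close>, the number of indices \<open>i\<close> such that \<open>r\<close> equals
  \<open>s\<^sub>1 \<dots> s\<^sub>i \<dots> s\<^sub>1\<close>.
\<close>
primrec refl_count :: "'a list \<Rightarrow> 'a \<Rightarrow> nat" where
  "refl_count [] r = 0"
| "refl_count (s # ws) r = of_bool (r = s) + refl_count ws (s \<otimes> r \<otimes> s)"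

lemma refl_count_append:
  assumes "us \<in> lists S" "r \<in> carrier W"
  shows "refl_count (us @ vs) r =
    refl_count us r + refl_count vs (inv (word_prod W us) \<otimes> r \<otimes> word_prod W us)"
  using assms by (induction us arbitrary: r) (auto simp: inv_mult_group m_assoc)

lemma relator_in_lists: "\<lbrakk>s \<in> S; t \<in> S\<rbrakk> \<Longrightarrow> concat (replicate j [s, t]) \<in> lists S"
  by (induction j) auto

lemma word_prod_relator:
  "\<lbrakk>s \<in> S; t \<in> S\<rbrakk> \<Longrightarrow> word_prod W (concat (replicate j [s, t])) = (s \<otimes> t) [^] j"
proof (induction j)
  case (Suc j)
  then show ?case using nat_pow_Suc2[of "s \<otimes> t" j] by (simp add: m_assoc del: nat_pow_Suc)
qed simp

text \<open>The reflections along the alternating word are the elements \<open>(s t)^i s\<close>.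
  Removing the first block \<open>[s, t]\<close> conjugates \<open>r\<close> by \<open>s\<close> and
  then by \<open>t\<close>, which shifts the exponent \<open>i\<close> by 2; the removed block
  accounts for the exponents 0 and 1.\<close>

lemma refl_count_relator:
  assumes "s \<in> S" "t \<in> S" "r \<in> carrier W"
  shows "refl_count (concat (replicate j [s, t])) r = (\<Sum>i<2*j. of_bool (r = (s \<otimes> t) [^] i \<otimes> s))"
  using assms(3)
proof (induction j arbitrary: r)
  case (Suc j)
  have c: "s \<in> carrier W" "t \<in> carrier W" using assms by auto
  have 1: "s \<otimes> r \<otimes> s = t \<longleftrightarrow> r = (s \<otimes> t) [^] Suc 0 \<otimes> s"
    using c assms Suc.prems by (auto simp: m_assoc)
  have 2: "t \<otimes> (s \<otimes> r \<otimes> s) \<otimes> t = (s \<otimes> t) [^] i \<otimes> s \<longleftrightarrow> r = (s \<otimes> t) [^] Suc (Suc i) \<otimes> s"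
    (is "?l = ?r \<longleftrightarrow> _") for i
  proof -
    define p where "p = (s \<otimes> t) [^] i"
    have p: "p \<in> carrier W" "p \<otimes> (s \<otimes> t) = (s \<otimes> t) \<otimes> p"
      using c nat_pow_Suc2[of "s \<otimes> t" i] by (simp_all add: p_def)
    have "?l = p \<otimes> s \<longleftrightarrow> (s \<otimes> t) \<otimes> ?l \<otimes> (t \<otimes> s) = (s \<otimes> t) \<otimes> (p \<otimes> s) \<otimes> (t \<otimes> s)"
      using c p Suc.prems by simp
    also have "(s \<otimes> t) \<otimes> ?l \<otimes> (t \<otimes> s) = r"
      using c assms Suc.prems by (simp add: m_assoc)
    also have "(s \<otimes> t) \<otimes> (p \<otimes> s) \<otimes> (t \<otimes> s) = ((s \<otimes> t) \<otimes> p) \<otimes> (s \<otimes> t) \<otimes> s"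
      using c p(1) by (simp add: m_assoc)
    also have "\<dots> = p \<otimes> (s \<otimes> t) \<otimes> (s \<otimes> t) \<otimes> s" by (simp only: p(2))
    finally show ?thesis by (simp add: p_def)
  qed
  show ?case
    using Suc.IH[of "t \<otimes> (s \<otimes> r \<otimes> s) \<otimes> t"] Suc.prems c
    by (simp add: sum.lessThan_Suc_shift 1 2 del: nat_pow_Suc sum.lessThan_Suc)
qed simp

text \<open>With \<open>m\<close> the order of \<open>s t\<close>, the exponents \<open>i\<close>
  and \<open>m + i\<close> give the same reflection, so the two halves of the sum agree. For
  infinite order \<open>m = 0\<close> and the word is empty.\<close>

lemma even_refl_count_relator:
  assumes "s \<in> S" "t \<in> S" "r \<in> carrier W"
  shows "even (refl_count (concat (replicate (ord (s \<otimes> t)) [s, t])) r)"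
proof -
  define m where "m = ord (s \<otimes> t)"
  let ?f = "\<lambda>i. of_bool (r = (s \<otimes> t) [^] (i::nat) \<otimes> s) :: nat"
  have c: "s \<in> carrier W" "t \<in> carrier W" using assms by auto
  have shift: "?f (m + i) = ?f i" for i
    using c by (simp add: m_def pow_ord_eq_1 flip: nat_pow_mult)
  have "(\<Sum>i<m + k. ?f i) = (\<Sum>i<m. ?f i) + (\<Sum>i<k. ?f (m + i))" for k
    by (induction k) (simp_all del: sum_of_bool_eq)
  from this[of m] have "(\<Sum>i<2*m. ?f i) = (\<Sum>i<m. ?f i) + (\<Sum>i<m. ?f (m + i))"
    by (simp only: mult_2)
  then have "even (\<Sum>i<2*m. ?f i)" by (simp add: shift)
  then show ?thesis using refl_count_relator[OF assms] by (simp add: m_def)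
qed

text \<open>Inserting a relator adds the count of a conjugate of \<open>r\<close> along that
  relator, which is even. The part after the relator sees the same conjugate as before, because the
  relator has product \<open>\<one>\<close>.\<close>

lemma coxeter_cong_refl_count:
  assumes "coxeter_cong W S us vs"
  shows "us \<in> lists S \<and> vs \<in> lists S \<and> word_prod W us = word_prod W vs \<and>
    (\<forall>r \<in> carrier W. even (refl_count us r) = even (refl_count vs r))"
  using assms
proof (induction rule: coxeter_cong.induct)
  case (rel us vs s t)
  let ?M = "concat (replicate (ord (s \<otimes> t)) [s, t])"
  have M: "?M \<in> lists S" "word_prod W ?M = \<one>"
    using rel relator_in_lists by (auto simp: word_prod_relator pow_ord_eq_1)
  have *: "us @ ?M @ vs \<in> lists S" "us @ vs \<in> lists S" "?M @ vs \<in> lists S"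
    using rel M(1) by (simp_all only: append_in_lists_conv)
  have "word_prod W (us @ ?M @ vs) = word_prod W (us @ vs)"
    using rel M(2) by (simp add: word_prod_append[OF _ *(3)] word_prod_append[OF M(1)] word_prod_append)
  moreover have "even (refl_count (us @ ?M @ vs) r) = even (refl_count (us @ vs) r)"
    if r: "r \<in> carrier W" for r
  proof -
    let ?r = "inv (word_prod W us) \<otimes> r \<otimes> word_prod W us"
    have r': "?r \<in> carrier W" using rel r by simp
    have "refl_count (?M @ vs) ?r = refl_count ?M ?r + refl_count vs ?r"
      using refl_count_append[OF M(1) r', of vs] r' unfolding M(2) by simp
    then show ?thesis
      using refl_count_append[of us r] rel r even_refl_count_relator[OF _ _ r', of s t] by simp
  qed
  ultimately show ?case using * by blast
qed auto

lemma refl_count_parity: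
  assumes "us \<in> lists S" "vs \<in> lists S" "word_prod W us = word_prod W vs" "r \<in> carrier W"
  shows "even (refl_count us r) = even (refl_count vs r)"
  using coxeter_cong_refl_count presentation assms by blast

text \<open>If \<open>r\<close> is the reflection belonging to a letter of \<open>ws\<close>,
  multiplying by \<open>r\<close> from the left cancels exactly that letter.\<close>

lemma refl_count_delete:
  assumes "ws \<in> lists S" "r \<in> carrier W" "refl_count ws r \<noteq> 0"
  shows "\<exists>vs \<in> lists S. Suc (length vs) = length ws \<and> word_prod W vs = r \<otimes> word_prod W ws"
  using assms
proof (induction ws arbitrary: r)
  case (Cons s ws)
  then have s: "s \<in> S" "s \<in> carrier W" and ws: "ws \<in> lists S" by auto
  show ?case
  proof (cases "r = s")
    case True
    then show ?thesis using s ws by (intro bexI[of _ ws]) auto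
  next
    case False
    then obtain vs where vs: "vs \<in> lists S" "Suc (length vs) = length ws"
      "word_prod W vs = s \<otimes> r \<otimes> s \<otimes> word_prod W ws"
      using Cons.IH[of "s \<otimes> r \<otimes> s"] Cons.prems s ws by auto
    then show ?thesis using s ws Cons.prems by (intro bexI[of _ "s # vs"]) (auto simp: m_assoc)
  qed
qed simp

text \<open>The parity depends only on the element, so it is still odd for a reduced word. There the
  count is nonzero, and deleting a letter gives a shorter word.\<close>

lemma len_refl_less:
  assumes "ws \<in> lists S" "r \<in> carrier W" "odd (refl_count ws r)"
  shows "len (r \<otimes> word_prod W ws) < len (word_prod W ws)"
proof -
  obtain us where us: "us \<in> lists S" "word_prod W us = word_prod W ws"
    "length us = len (word_prod W ws)"
    using ex_reduced_word[of "word_prod W ws"] assms by auto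
  then have "odd (refl_count us r)" using refl_count_parity assms by metis
  then obtain vs where "vs \<in> lists S" "Suc (length vs) = length us"
      "word_prod W vs = r \<otimes> word_prod W us"
    using refl_count_delete[of us r] us assms by force
  then show ?thesis using len_word_le[of vs] us by auto
qed

text \<open>For the converse, prefixing \<open>s\<close> changes the count of \<open>s\<close> by
  one, since conjugating \<open>s\<close> by itself returns \<open>s\<close>. An even count along
  \<open>ws\<close> is therefore odd along \<open>s # ws\<close>, and the length drops in the other
  direction.\<close>

lemma len_gen_less_iff:
  assumes "ws \<in> lists S" "s \<in> S"
  shows "len (s \<otimes> word_prod W ws) < len (word_prod W ws) \<longleftrightarrow> odd (refl_count ws s)"
proof (cases "odd (refl_count ws s)")
  case True
  then show ?thesis using len_refl_less assms by auto
next
  case False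
  have "odd (refl_count (s # ws) s)" using False assms by (simp add: m_assoc)
  then have "len (s \<otimes> word_prod W (s # ws)) < len (word_prod W (s # ws))"
    by (intro len_refl_less) (use assms in auto)
  then show ?thesis using False assms by simp
qed

lemma len_gen_neq:
  assumes "s \<in> S" "w \<in> carrier W"
  shows "len (s \<otimes> w) \<noteq> len w"
proof -
  obtain ws where ws: "ws \<in> lists S" "word_prod W ws = w"
    using ex_word assms by blast
  have "len w < len (s \<otimes> w)" if "even (refl_count ws s)"
    using len_gen_less_iff[of "s # ws" s] assms ws that by (auto simp: m_assoc)
  then show ?thesis using len_gen_less_iff[of ws s] assms ws by auto
qed

lemma len_gen_mult:
  assumes "s \<in> S" "w \<in> carrier W"
  shows "len (s \<otimes> w) = Suc (len w) \<or> len w = Suc (len (s \<otimes> w))"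
  using len_gen_neq[OF assms] len_mult_le[of s w] len_mult_le[of s "s \<otimes> w"] assms len_gen[of s]
  by auto

section \<open>Length-additive products and the two weak orders\<close>

text \<open>Both weak orders are instances of this relation (\<open>le_R_iff\<close>,
  \<open>le_L_iff\<close>), so order arguments become regroupings of factors.\<close>

definition reduced :: "'a \<Rightarrow> 'a \<Rightarrow> bool" where
  "reduced x y \<longleftrightarrow> len (x \<otimes> y) = len x + len y"

text \<open>By subadditivity, each side says that the length of the triple product is the sum of the
  three lengths. Transitivity and cancellation for both orders follow from this.\<close>

lemma reduced_assoc:
  assumes "x \<in> carrier W" "y \<in> carrier W" "z \<in> carrier W"
  shows "reduced x y \<and> reduced (x \<otimes> y) z \<longleftrightarrow> reduced y z \<and> reduced x (y \<otimes> z)"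
  using assms len_mult_le[of x y] len_mult_le[of "x \<otimes> y" z] len_mult_le[of y z]
    len_mult_le[of x "y \<otimes> z"]
  unfolding reduced_def by (auto simp: m_assoc)

lemma le_R_iff: "u \<preceq>\<^sub>R v \<longleftrightarrow> u \<in> carrier W \<and> v \<in> carrier W \<and> reduced u (inv u \<otimes> v)"
  unfolding weak_le_R_def reduced_def by auto

lemma le_L_iff: "u \<preceq>\<^sub>L v \<longleftrightarrow> u \<in> carrier W \<and> v \<in> carrier W \<and> reduced (v \<otimes> inv u) u"
  unfolding weak_le_L_def reduced_def by (auto simp: m_assoc)

lemma le_R_carrier: "u \<preceq>\<^sub>R v \<Longrightarrow> u \<in> carrier W" "u \<preceq>\<^sub>R v \<Longrightarrow> v \<in> carrier W"
  by (simp_all add: weak_le_R_def)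

lemma le_L_carrier: "u \<preceq>\<^sub>L v \<Longrightarrow> u \<in> carrier W" "u \<preceq>\<^sub>L v \<Longrightarrow> v \<in> carrier W"
  by (simp_all add: weak_le_L_def)

lemma le_R_mult: "\<lbrakk>x \<in> carrier W; y \<in> carrier W\<rbrakk> \<Longrightarrow> x \<preceq>\<^sub>R x \<otimes> y \<longleftrightarrow> reduced x y"
  by (simp add: le_R_iff)

lemma le_L_mult: "\<lbrakk>x \<in> carrier W; y \<in> carrier W\<rbrakk> \<Longrightarrow> y \<preceq>\<^sub>L x \<otimes> y \<longleftrightarrow> reduced x y"
  by (simp add: le_L_iff m_assoc)

lemma le_R_refl [simp]: "x \<in> carrier W \<Longrightarrow> x \<preceq>\<^sub>R x"
  by (simp add: weak_le_R_def)

lemma le_L_refl [simp]: "x \<in> carrier W \<Longrightarrow> x \<preceq>\<^sub>L x"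
  by (simp add: weak_le_L_def)

lemma one_le_R [simp]: "x \<in> carrier W \<Longrightarrow> \<one> \<preceq>\<^sub>R x"
  by (simp add: weak_le_R_def)

lemma le_R_mult_mono:
  assumes "x \<in> carrier W" "y \<in> carrier W" "z \<in> carrier W" "reduced x y" "reduced x z"
  shows "x \<otimes> y \<preceq>\<^sub>R x \<otimes> z \<longleftrightarrow> y \<preceq>\<^sub>R z"
  using assms reduced_assoc[of x y "inv y \<otimes> z"]
  by (auto simp: le_R_iff inv_mult_group m_assoc)

lemma le_L_mult_mono:
  assumes "x \<in> carrier W" "y \<in> carrier W" "z \<in> carrier W" "reduced x z" "reduced y z"
  shows "x \<otimes> z \<preceq>\<^sub>L y \<otimes> z \<longleftrightarrow> x \<preceq>\<^sub>L y"
  using assms reduced_assoc[of "y \<otimes> inv x" x z]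
  by (auto simp: le_L_iff inv_mult_group m_assoc)

lemma le_R_trans:
  assumes "x \<preceq>\<^sub>R y" "y \<preceq>\<^sub>R z"
  shows "x \<preceq>\<^sub>R z"
  using assms reduced_assoc[of x "inv x \<otimes> y" "inv y \<otimes> z"]
  by (auto simp: le_R_iff inv_mult_group m_assoc)

lemma le_L_trans:
  assumes "x \<preceq>\<^sub>L y" "y \<preceq>\<^sub>L z"
  shows "x \<preceq>\<^sub>L z"
  using assms reduced_assoc[of "z \<otimes> inv y" "y \<otimes> inv x" x]
  by (auto simp: le_L_iff inv_mult_group m_assoc)

lemma le_R_len: "x \<preceq>\<^sub>R y \<Longrightarrow> len x \<le> len y"
  by (simp add: weak_le_R_def)

lemma le_L_eq:
  assumes "x \<preceq>\<^sub>L y" "len y \<le> len x"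
  shows "x = y"
proof -
  have c: "x \<in> carrier W" "y \<in> carrier W" using assms le_L_carrier by auto
  have "y \<otimes> inv x = \<one>" using assms c by (intro len_eq_0) (auto simp: weak_le_L_def)
  then show ?thesis using c by (metis inv_equality inv_closed inv_inv)
qed

lemma le_L_len: "x \<preceq>\<^sub>L y \<Longrightarrow> len x \<le> len y"
  by (simp add: weak_le_L_def)

section \<open>Descents, lifting and covers\<close>

lemma left_descents_iff_le_R:
  assumes "s \<in> S" "w \<in> carrier W"
  shows "s \<in> left_descents W S w \<longleftrightarrow> s \<preceq>\<^sub>R w"
  using assms len_gen_mult[of s w] len_gen[of s] by (auto simp: left_descents_def weak_le_R_def)

lemma left_descents_iff_not_reduced:
  assumes "s \<in> S" "w \<in> carrier W"
  shows "s \<in> left_descents W S w \<longleftrightarrow> \<not> reduced s w"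
  using assms len_gen_mult[of s w] len_gen[of s] by (auto simp: left_descents_def reduced_def)

text \<open>Split a word for \<open>w\<close> into a word for \<open>u\<close> followed by
  \<open>zs\<close>. The count of \<open>s\<close> is odd along the whole word but even along the
  first part, so the conjugate of \<open>s\<close> by \<open>u\<close> has odd count along
  \<open>zs\<close>, and multiplying by it shortens the remainder.\<close>

lemma lifting:
  assumes s: "s \<in> S" "s \<preceq>\<^sub>R w" and u: "u \<preceq>\<^sub>R w" and su: "reduced s u"
  shows "s \<otimes> u \<preceq>\<^sub>R w"
proof -
  have c: "s \<in> carrier W" "w \<in> carrier W" "u \<in> carrier W" using assms le_R_carrier by auto
  obtain us where us: "us \<in> lists S" "word_prod W us = u"
    using ex_word c by blast
  obtain zs where zs: "zs \<in> lists S" "word_prod W zs = inv u \<otimes> w"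
    using ex_word[of "inv u \<otimes> w"] c by auto
  have "odd (refl_count (us @ zs) s)"
    using len_gen_less_iff[of "us @ zs" s] us zs c s left_descents_iff_le_R[of s w]
    by (auto simp: word_prod_append left_descents_def)
  moreover have "even (refl_count us s)"
    using len_gen_less_iff[of us s] us s su by (auto simp: reduced_def len_gen)
  ultimately have "odd (refl_count zs (inv u \<otimes> s \<otimes> u))"
    using refl_count_append[of us s zs] us c by simp
  then have "len (inv u \<otimes> s \<otimes> u \<otimes> word_prod W zs) < len (word_prod W zs)"
    by (intro len_refl_less) (use zs c in auto)
  then have "len (inv u \<otimes> (s \<otimes> w)) < len (inv u \<otimes> w)"
    using zs c by (simp add: m_assoc)
  \<comment> \<open>Together with the strict inequality above and the length additivity of
    \<open>u\<close> in \<open>w\<close>, this bound has no slack, so lengths are additive for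
    \<open>s \<otimes> u\<close> as well.\<close>
  moreover have "len w \<le> len (s \<otimes> u) + len (inv u \<otimes> (s \<otimes> w))"
    using len_mult_le[of "s \<otimes> u" "inv u \<otimes> (s \<otimes> w)"] c s by (simp add: m_assoc)
  ultimately show ?thesis
    using c s u su by (auto simp: weak_le_R_def reduced_def len_gen inv_mult_group m_assoc)
qed

text \<open>By lifting, \<open>t\<close> lies below \<open>w\<close> and \<open>s \<otimes> t\<close> is reduced, so \<open>s \<otimes> t\<close> is a prefix of \<open>w\<close>.\<close>
lemma left_descent_mult:
  assumes "s \<in> left_descents W S w" "t \<in> left_descents W S w" "s \<noteq> t" "w \<in> carrier W"
  shows "t \<in> left_descents W S (s \<otimes> w)"
proof -
  have S: "s \<in> S" "t \<in> S" using assms by (auto simp: left_descents_def)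
  have "len (s \<otimes> t) \<noteq> 0"
  proof
    assume "len (s \<otimes> t) = 0"
    then have "s \<otimes> t = \<one>" using len_eq_0 S by auto
    then have "inv t = s" using inv_equality S gen_carrier by blast
    then show False using assms S by simp
  qed
  then have st: "reduced s t" using len_gen_mult[of s t] S by (auto simp: reduced_def len_gen)
  then have "s \<otimes> t \<preceq>\<^sub>R w" using lifting[of s w t] left_descents_iff_le_R assms S by auto
  then have "t \<preceq>\<^sub>R s \<otimes> w"
    using S st assms le_R_mult_mono[of s t "s \<otimes> w"] left_descents_iff_le_R[of s w]
    by (auto simp: le_R_iff)
  then show ?thesis using left_descents_iff_le_R S assms by auto
qed

lemma ex_first_letter:
  assumes "w \<in> carrier W" "w \<noteq> \<one>"
  obtains s w' where "s \<in> S" "w' \<in> carrier W" "w = s \<otimes> w'" "reduced s w'"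
proof -
  obtain ws where ws: "ws \<in> lists S" "word_prod W ws = w" "length ws = len w"
    using assms(1) by (rule ex_reduced_word)
  then obtain s vs where "ws = s # vs" using assms by (cases ws) auto
  then show ?thesis
    using that[of s "word_prod W vs"] ws len_word_le[of vs] len_mult_le[of s "word_prod W vs"]
    by (auto simp: reduced_def len_gen)
qed

lemma ex_last_letter:
  assumes "w \<in> carrier W" "w \<noteq> \<one>"
  obtains s w' where "s \<in> S" "w' \<in> carrier W" "w = w' \<otimes> s" "reduced w' s"
proof -
  have "inv w \<noteq> \<one>" using assms by (metis inv_inv inv_one)
  then obtain s v where v: "s \<in> S" "v \<in> carrier W" "inv w = s \<otimes> v" "reduced s v"
    using ex_first_letter[of "inv w"] assms by auto
  then have w: "w = inv v \<otimes> s" using assms by (metis inv_inv inv_mult_group gen_inv gen_carrier)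
  have "len (inv v \<otimes> s) = len (s \<otimes> v)" using v w assms by (metis len_inv)
  then have "reduced (inv v) s" using v by (simp add: reduced_def)
  then show ?thesis using that[of s "inv v"] v w by auto
qed

lemma ex_cover_R:
  assumes "z \<preceq>\<^sub>R x" "z \<noteq> x"
  obtains s where "s \<in> S" "reduced z s" "z \<otimes> s \<preceq>\<^sub>R x"
proof -
  define g where "g = inv z \<otimes> x"
  have c: "z \<in> carrier W" "x \<in> carrier W" "g \<in> carrier W" "x = z \<otimes> g" "reduced z g"
    using assms by (auto simp: le_R_iff g_def)
  then have "g \<noteq> \<one>" using assms by auto
  then obtain s g' where g: "s \<in> S" "g' \<in> carrier W" "g = s \<otimes> g'" "reduced s g'"
    using ex_first_letter c by metis
  then have "reduced z s" "reduced (z \<otimes> s) g'"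
    using c reduced_assoc[of z s g'] by auto
  then show ?thesis using that[of s] g c le_R_mult[of "z \<otimes> s" g'] by (simp add: m_assoc)
qed

lemma ex_cover_L:
  assumes "z \<preceq>\<^sub>L x" "z \<noteq> x"
  obtains s where "s \<in> S" "reduced s z" "s \<otimes> z \<preceq>\<^sub>L x"
proof -
  define g where "g = x \<otimes> inv z"
  have c: "z \<in> carrier W" "x \<in> carrier W" "g \<in> carrier W" "x = g \<otimes> z" "reduced g z"
    using assms by (auto simp: le_L_iff g_def m_assoc)
  then have "g \<noteq> \<one>" using assms by auto
  then obtain s g' where g: "s \<in> S" "g' \<in> carrier W" "g = g' \<otimes> s" "reduced g' s"
    using ex_last_letter c by metis
  then have "reduced s z" "reduced g' (s \<otimes> z)"
    using c reduced_assoc[of g' s z] by auto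
  then show ?thesis using that[of s] g c le_L_mult[of g' "s \<otimes> z"] by (simp add: m_assoc)
qed

section \<open>Translating intervals\<close>

lemma reduced_prefix:
  assumes "reduced z v" "d \<preceq>\<^sub>R v" "z \<in> carrier W"
  shows "reduced z d"
  using assms reduced_assoc[of z d "inv d \<otimes> v"] by (auto simp: le_R_iff)

lemma reduced_suffix:
  assumes "reduced w u" "x \<preceq>\<^sub>L w" "u \<in> carrier W"
  shows "reduced x u"
  using assms reduced_assoc[of "w \<otimes> inv x" x u] by (auto simp: le_L_iff m_assoc)

lemma le_R_mult_iff:
  assumes "x \<preceq>\<^sub>R j" "u \<in> carrier W" "reduced x u"
  shows "j \<preceq>\<^sub>R x \<otimes> u \<longleftrightarrow> inv x \<otimes> j \<preceq>\<^sub>R u" "x \<otimes> u \<preceq>\<^sub>R j \<longleftrightarrow> u \<preceq>\<^sub>R inv x \<otimes> j"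
  using assms le_R_mult_mono[of x "inv x \<otimes> j" u] le_R_mult_mono[of x u "inv x \<otimes> j"]
  by (auto simp: le_R_iff)

lemma le_L_antisym: "\<lbrakk>x \<preceq>\<^sub>L y; y \<preceq>\<^sub>L x\<rbrakk> \<Longrightarrow> x = y"
  using le_L_eq le_L_len by blast

lemma le_L_decomp:
  assumes "u \<preceq>\<^sub>L v"
  obtains w where "w \<in> carrier W" "v = w \<otimes> u" "reduced w u"
  using assms that[of "v \<otimes> inv u"] by (auto simp: le_L_iff m_assoc)

text \<open>Right multiplication by \<open>u\<close> preserves and reflects
  \<open>\<preceq>\<^sub>L\<close> on factors that are reduced against \<open>u\<close>, and every
  suffix of \<open>w\<close> is such a factor. Up to isomorphism the interval thus depends on
  \<open>w\<close> alone.\<close>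

lemma interval_L_eq_image:
  assumes "w \<in> carrier W" "u \<in> carrier W" "reduced w u"
  shows "interval_L W S u (w \<otimes> u) = (\<lambda>x. x \<otimes> u) ` {x. x \<preceq>\<^sub>L w}"
proof (intro equalityI subsetI)
  fix y assume "y \<in> interval_L W S u (w \<otimes> u)"
  then have y: "u \<preceq>\<^sub>L y" "y \<preceq>\<^sub>L w \<otimes> u" by (auto simp: interval_L_def)
  from y(1) obtain x where x: "x \<in> carrier W" "y = x \<otimes> u" "reduced x u" by (rule le_L_decomp)
  then show "y \<in> (\<lambda>x. x \<otimes> u) ` {x. x \<preceq>\<^sub>L w}"
    using y(2) assms le_L_mult_mono by auto
next
  fix y assume "y \<in> (\<lambda>x. x \<otimes> u) ` {x. x \<preceq>\<^sub>L w}"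
  then obtain x where x: "x \<preceq>\<^sub>L w" "y = x \<otimes> u" by auto
  then show "y \<in> interval_L W S u (w \<otimes> u)"
    using assms le_L_mult_mono[of x w u] reduced_suffix[of w u x] le_L_carrier[of x w]
    by (auto simp: interval_L_def le_L_mult)
qed

text \<open>Anything above \<open>w \<otimes> p\<close> also lies above \<open>w\<close>, so
  \<open>w\<close> can be cancelled. This later carries the interval of minima to the
  maxima.\<close>

lemma interval_R_mult:
  assumes "w \<in> carrier W" "p \<preceq>\<^sub>R q" "reduced w q"
  shows "interval_R W S (w \<otimes> p) (w \<otimes> q) = (\<lambda>u. w \<otimes> u) ` interval_R W S p q"
proof (intro equalityI subsetI)
  have c: "p \<in> carrier W" "q \<in> carrier W" "reduced w p"
    using assms reduced_prefix[of w q p] by (auto simp: le_R_carrier)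
  fix y assume "y \<in> interval_R W S (w \<otimes> p) (w \<otimes> q)"
  then have y: "w \<otimes> p \<preceq>\<^sub>R y" "y \<preceq>\<^sub>R w \<otimes> q" by (auto simp: interval_R_def)
  then have "w \<preceq>\<^sub>R y" using c assms le_R_trans le_R_mult by blast
  then show "y \<in> (\<lambda>u. w \<otimes> u) ` interval_R W S p q"
    using y c assms le_R_mult_iff[of w y p] le_R_mult_iff[of w y q] le_R_carrier[of w y]
    by (intro image_eqI[of _ _ "inv w \<otimes> y"]) (auto simp: interval_R_def)
next
  have c: "p \<in> carrier W" "q \<in> carrier W" "reduced w p"
    using assms reduced_prefix[of w q p] by (auto simp: le_R_carrier)
  fix y assume "y \<in> (\<lambda>u. w \<otimes> u) ` interval_R W S p q"
  then obtain u where "p \<preceq>\<^sub>R u" "u \<preceq>\<^sub>R q" "y = w \<otimes> u" by (auto simp: interval_R_def)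
  then show "y \<in> interval_R W S (w \<otimes> p) (w \<otimes> q)"
    using c assms reduced_prefix[of w q u] le_R_mult_mono[of w p u] le_R_mult_mono[of w u q]
      le_R_carrier[of p u]
    by (auto simp: interval_R_def)
qed

section \<open>Descent-preserving isomorphisms\<close>

text \<open>A description, free of isomorphisms, of the minima of the intervals equivalent to the
  one from \<open>u\<^sub>0\<close> to \<open>w \<otimes> u\<^sub>0\<close>; see
  \<open>min_max_elems_eq\<close>.\<close>

definition descent_class :: "'a \<Rightarrow> 'a \<Rightarrow> 'a set" where
  "descent_class w u\<^sub>0 = {u \<in> carrier W. reduced w u \<and>
     (\<forall>x. x \<preceq>\<^sub>L w \<longrightarrow> left_descents W S (x \<otimes> u) = left_descents W S (x \<otimes> u\<^sub>0))}"

text \<open>The map sends \<open>x \<otimes> u\<^sub>0\<close> to \<open>x \<otimes> u\<close> for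
  every \<open>x\<close> below \<open>w\<close>; both intervals are copies of the same lower
  set.\<close>

lemma descent_iso_shift:
  assumes "w \<in> carrier W" "u\<^sub>0 \<in> carrier W" "reduced w u\<^sub>0" "u \<in> descent_class w u\<^sub>0"
  shows "descent_iso W S (interval_L W S u\<^sub>0 (w \<otimes> u\<^sub>0)) (interval_L W S u (w \<otimes> u))
    (\<lambda>y. y \<otimes> inv u\<^sub>0 \<otimes> u)"
proof -
  have u: "u \<in> carrier W" "reduced w u"
    "x \<preceq>\<^sub>L w \<Longrightarrow> left_descents W S (x \<otimes> u) = left_descents W S (x \<otimes> u\<^sub>0)" for x
    using assms by (auto simp: descent_class_def)
  have shift: "x \<otimes> u\<^sub>0 \<otimes> inv u\<^sub>0 \<otimes> u = x \<otimes> u" if "x \<preceq>\<^sub>L w" for x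
    using assms u le_L_carrier[OF that] by (simp add: m_assoc)
  have "x = y" if "x \<preceq>\<^sub>L w" "y \<preceq>\<^sub>L w" "x \<otimes> u = y \<otimes> u" for x y
    using that u(1) le_L_carrier(1)[OF that(1)] le_L_carrier(1)[OF that(2)] by simp
  then have inj: "inj_on (\<lambda>y. y \<otimes> inv u\<^sub>0 \<otimes> u) ((\<lambda>x. x \<otimes> u\<^sub>0) ` {x. x \<preceq>\<^sub>L w})"
    by (auto simp: inj_on_def shift)
  have img: "(\<lambda>y. y \<otimes> inv u\<^sub>0 \<otimes> u) ` (\<lambda>x. x \<otimes> u\<^sub>0) ` {x. x \<preceq>\<^sub>L w} = (\<lambda>x. x \<otimes> u) ` {x. x \<preceq>\<^sub>L w}"
    unfolding image_image using shift by (intro image_cong) auto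
  have mono: "x \<otimes> v \<preceq>\<^sub>L y \<otimes> v \<longleftrightarrow> x \<preceq>\<^sub>L y"
    if "x \<preceq>\<^sub>L w" "y \<preceq>\<^sub>L w" "v \<in> carrier W" "reduced w v" for x y v
    using that by (intro le_L_mult_mono) (auto intro: reduced_suffix dest: le_L_carrier)
  show ?thesis
    unfolding descent_iso_def bij_betw_def interval_L_eq_image[OF assms(1,2,3)]
      interval_L_eq_image[OF assms(1) u(1,2)]
    by (intro conjI inj img) (simp_all add: shift mono assms(2,3) u)
qed

text \<open>The isomorphism is forced: climbing from \<open>u\<^sub>0\<close> one cover at a time
  shows that \<open>f\<close> is the translation \<open>x \<otimes> u\<^sub>0\<close> to
  \<open>x \<otimes> u\<close>. Comparing top elements then gives \<open>v\<close>, and the descent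
  conditions can be read off.\<close>

lemma descent_iso_imp_descent_class:
  assumes w: "w \<in> carrier W" "u\<^sub>0 \<in> carrier W" "reduced w u\<^sub>0" and uv: "u \<preceq>\<^sub>L v"
    and iso: "descent_iso W S (interval_L W S u\<^sub>0 (w \<otimes> u\<^sub>0)) (interval_L W S u v) f"
  shows "v = w \<otimes> u \<and> u \<in> descent_class w u\<^sub>0"
proof -
  define I where "I = interval_L W S u\<^sub>0 (w \<otimes> u\<^sub>0)"
  define J where "J = interval_L W S u v"
  have c: "u \<in> carrier W" "v \<in> carrier W" using uv le_L_carrier by auto
  have I: "I = (\<lambda>x. x \<otimes> u\<^sub>0) ` {x. x \<preceq>\<^sub>L w}" using interval_L_eq_image w by (simp add: I_def)
  have bij: "bij_betw f I J"
    and ord: "\<And>x y. \<lbrakk>x \<in> I; y \<in> I\<rbrakk> \<Longrightarrow> f x \<preceq>\<^sub>L f y \<longleftrightarrow> x \<preceq>\<^sub>L y"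
    and des: "\<And>x. x \<in> I \<Longrightarrow> left_descents W S (f x) = left_descents W S x"
    using iso by (auto simp: descent_iso_def I_def J_def)
  have fJ: "u \<preceq>\<^sub>L f x" "f x \<preceq>\<^sub>L v" if "x \<in> I" for x
    using bij_betwE[OF bij] that by (auto simp: J_def interval_L_def)
  have ex: "\<exists>p\<in>I. f p = y" if "u \<preceq>\<^sub>L y" "y \<preceq>\<^sub>L v" for y
    using bij that by (auto simp: bij_betw_def J_def interval_L_def image_iff set_eq_iff) metis
  have I_bounds: "u\<^sub>0 \<preceq>\<^sub>L x" "x \<preceq>\<^sub>L w \<otimes> u\<^sub>0" if "x \<in> I" for x
    using that by (auto simp: I_def interval_L_def)
  have I_mem: "u\<^sub>0 \<in> I" "w \<otimes> u\<^sub>0 \<in> I"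
    using w by (auto simp: I_def interval_L_def le_L_mult)
  have f: "f (x \<otimes> u\<^sub>0) = x \<otimes> u" if "x \<preceq>\<^sub>L w" for x
    using that
  proof (induction "len x" arbitrary: x)
    case 0
    then have x: "x = \<one>" using len_eq_0 le_L_carrier by metis
    obtain p where p: "p \<in> I" "f p = u" using ex[of u] c uv by auto
    have "f u\<^sub>0 \<preceq>\<^sub>L u" using ord[OF I_mem(1) p(1)] p I_bounds by simp
    then have "f u\<^sub>0 = u" using fJ[OF I_mem(1)] le_L_antisym by blast
    then show ?case using x w c by simp
  next
    case (Suc n)
    have x: "x \<in> carrier W" "x \<noteq> \<one>" using Suc le_L_carrier by auto
    then obtain s x' where s: "s \<in> S" "x' \<in> carrier W" "x = s \<otimes> x'" "reduced s x'"
      by (rule ex_first_letter)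
    have x'x: "x' \<preceq>\<^sub>L x" using s by (simp add: le_L_mult)
    then have x': "x' \<preceq>\<^sub>L w" using Suc.prems le_L_trans by blast
    define y where "y = x \<otimes> u\<^sub>0"
    define y' where "y' = x' \<otimes> u\<^sub>0"
    have y: "y \<in> I" "y' \<in> I" "y = s \<otimes> y'" "y \<in> carrier W" "y' \<in> carrier W"
      using x' Suc.prems s x w by (auto simp add: I y_def y'_def) (simp add: m_assoc)
    have fy: "f y \<in> carrier W" "f y' \<in> carrier W" using y fJ le_L_carrier by blast+
    have fy': "f y' = x' \<otimes> u"
      unfolding y'_def using Suc.hyps s x' by (intro Suc.hyps) (auto simp: reduced_def len_gen)
    have red: "reduced s y'"
      using reduced_assoc[of s x' u\<^sub>0] s w reduced_suffix[of w u\<^sub>0 x] Suc.prems by (simp add: y'_def)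
    then have y'y: "y' \<preceq>\<^sub>L y" "len y = Suc (len y')"
      using y s by (auto simp: le_L_mult reduced_def len_gen)
    have "f y' \<noteq> f y"
      using inj_onD[OF bij_betw_imp_inj_on[OF bij]] y(1,2) y'y(2) by fastforce
    moreover have "f y' \<preceq>\<^sub>L f y" using ord y y'y by blast
    ultimately obtain t where t: "t \<in> S" "reduced t (f y')" "t \<otimes> f y' \<preceq>\<^sub>L f y"
      using ex_cover_L by blast
    have "f y' \<preceq>\<^sub>L t \<otimes> f y'" using t fy by (simp add: le_L_mult)
    \<comment> \<open>\<open>p\<close> is the preimage of a cover of \<open>f y'\<close>. It lies
      between \<open>y'\<close> and \<open>y\<close>, whose lengths differ by one, and differs from
      \<open>y'\<close>; so \<open>p = y\<close>, and the cover is sent to a cover.\<close>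
    moreover obtain p where p: "p \<in> I" "f p = t \<otimes> f y'"
      using ex[of "t \<otimes> f y'"] fJ y t calculation le_L_trans by blast
    ultimately have y'p: "y' \<preceq>\<^sub>L p" "p \<preceq>\<^sub>L y"
      using ord[of y' p] ord[of p y] t(3) y(1,2) by simp_all
    then have "len p \<le> len y' \<or> len y \<le> len p"
      using y'y(2) by linarith
    then have "p = y' \<or> p = y"
      using y'p le_L_eq by blast
    moreover have "p \<noteq> y'"
      using p t fy by (auto simp: reduced_def len_gen)
    ultimately have fyt: "f y = t \<otimes> f y'" using p by simp
    \<comment> \<open>Both letters are descents of \<open>f y\<close>. If they were distinct,
      \<open>s\<close> would survive as a descent of \<open>t \<otimes> f y = f y'\<close>, hence of
      \<open>y'\<close>, although \<open>s \<otimes> y'\<close> is reduced.\<close>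
    have "s = t"
    proof (rule ccontr)
      assume "s \<noteq> t"
      have "t \<in> left_descents W S (f y)" "s \<in> left_descents W S y"
        using red t s fy y unfolding fyt
        by (auto simp: left_descents_def y(3) reduced_def len_gen)
      then have "s \<in> left_descents W S (t \<otimes> f y)"
        using left_descent_mult[of t "f y" s] des y fy \<open>s \<noteq> t\<close> by auto
      moreover have "t \<otimes> f y = f y'" using t fy by (simp add: fyt)
      ultimately have "s \<in> left_descents W S y'" using des[OF y(2)] by simp
      then show False using left_descents_iff_not_reduced s y red by blast
    qed
    then show ?case using fyt fy' s c by (simp add: y_def m_assoc)
  qed
  obtain p where p: "p \<in> I" "f p = v" using ex[of v] c uv by auto
  have "v \<preceq>\<^sub>L f (w \<otimes> u\<^sub>0)" using ord[OF p(1) I_mem(2)] p I_bounds by simp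
  then have "f (w \<otimes> u\<^sub>0) = v" using fJ[OF I_mem(2)] le_L_antisym by blast
  then have v: "v = w \<otimes> u" using f w by simp
  moreover have "reduced w u" using uv v c w by (simp add: le_L_mult)
  moreover have "left_descents W S (x \<otimes> u) = left_descents W S (x \<otimes> u\<^sub>0)" if "x \<preceq>\<^sub>L w" for x
    using des[of "x \<otimes> u\<^sub>0"] f[OF that] that I by auto
  ultimately show ?thesis using c by (simp add: descent_class_def)
qed

lemma descent_equiv_class_iff:
  assumes "w \<in> carrier W" "u\<^sub>0 \<in> carrier W" "reduced w u\<^sub>0" "u \<preceq>\<^sub>L v"
  shows "interval_L W S u v \<in> descent_equiv W S `` {interval_L W S u\<^sub>0 (w \<otimes> u\<^sub>0)} \<longleftrightarrow>
    v = w \<otimes> u \<and> u \<in> descent_class w u\<^sub>0"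
proof -
  have "interval_L W S u v \<in> left_intervals W S"
    "interval_L W S u\<^sub>0 (w \<otimes> u\<^sub>0) \<in> left_intervals W S"
    unfolding left_intervals_def using assms le_L_mult[of w u\<^sub>0] by blast+
  then show ?thesis
    using descent_iso_imp_descent_class[OF assms] descent_iso_shift[OF assms(1-3)]
    by (auto simp: descent_equiv_def)
qed

lemma min_max_elems_eq:
  assumes "w \<in> carrier W" "u\<^sub>0 \<in> carrier W" "reduced w u\<^sub>0"
    and C: "C = descent_equiv W S `` {interval_L W S u\<^sub>0 (w \<otimes> u\<^sub>0)}"
  shows "min_elems W S C = descent_class w u\<^sub>0"
    and "max_elems W S C = (\<lambda>u. w \<otimes> u) ` descent_class w u\<^sub>0"
proof -
  have iff: "u \<preceq>\<^sub>L v \<and> interval_L W S u v \<in> C \<longleftrightarrow> v = w \<otimes> u \<and> u \<in> descent_class w u\<^sub>0" for u v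
    using descent_equiv_class_iff[OF assms(1-3), of u v] assms(1)
    by (auto simp: C descent_class_def le_L_mult)
  show "min_elems W S C = descent_class w u\<^sub>0"
    and "max_elems W S C = (\<lambda>u. w \<otimes> u) ` descent_class w u\<^sub>0"
    unfolding min_elems_def max_elems_def iff by auto
qed

section \<open>Preparations for joins in the right weak order\<close>

text \<open>For \<open>J \<subseteq> S\<close> these are the elements with a reduced word in letters
  of \<open>J\<close>. They are built by left multiplication so that each step matches one use of
  \<open>lifting\<close>.\<close>

inductive_set lift_closure :: "'a set \<Rightarrow> 'a set" for J where
  one: "\<one> \<in> lift_closure J"
| mult: "\<lbrakk>x \<in> lift_closure J; s \<in> J; reduced s x\<rbrakk> \<Longrightarrow> s \<otimes> x \<in> lift_closure J"

lemma lift_closure_carrier: "\<lbrakk>x \<in> lift_closure J; J \<subseteq> S\<rbrakk> \<Longrightarrow> x \<in> carrier W"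
  by (induction rule: lift_closure.induct) auto

lemma lift_closure_le_R:
  "\<lbrakk>x \<in> lift_closure J; J \<subseteq> S; v \<in> carrier W; \<And>s. s \<in> J \<Longrightarrow> s \<preceq>\<^sub>R v\<rbrakk> \<Longrightarrow> x \<preceq>\<^sub>R v"
  by (induction rule: lift_closure.induct) (auto intro: lifting)

text \<open>Stated as an equivalence, so that a family of lower bounds on \<open>v\<close> can be
  rewritten into a single one. The carrier condition on \<open>v\<close> matters when
  \<open>A\<close> is empty.\<close>

definition is_lub :: "'a set \<Rightarrow> 'a \<Rightarrow> bool" where
  "is_lub A j \<longleftrightarrow> (\<forall>v. j \<preceq>\<^sub>R v \<longleftrightarrow> v \<in> carrier W \<and> (\<forall>a\<in>A. a \<preceq>\<^sub>R v))"

lemma is_lub_upper: "\<lbrakk>is_lub A j; j \<in> carrier W; a \<in> A\<rbrakk> \<Longrightarrow> a \<preceq>\<^sub>R j"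
  by (metis is_lub_def le_R_refl)

lemma is_lub_le_iff: "is_lub A j \<Longrightarrow> j \<preceq>\<^sub>R v \<longleftrightarrow> v \<in> carrier W \<and> (\<forall>a\<in>A. a \<preceq>\<^sub>R v)"
  by (simp add: is_lub_def)

end

section \<open>The longest element and the lattice property\<close>

locale finite_coxeter_system = coxeter_system +
  assumes finite_carrier: "finite (carrier W)"
begin

text \<open>An element of maximal length has every generator as a left descent, so
  \<open>lifting\<close> along a reduced word of \<open>u\<close> puts \<open>u\<close> below
  it.\<close>

lemma ex_longest: "\<exists>w\<^sub>0 \<in> carrier W. \<forall>u \<in> carrier W. u \<preceq>\<^sub>R w\<^sub>0"
proof -
  obtain w\<^sub>0 where w\<^sub>0: "w\<^sub>0 \<in> carrier W" "\<And>x. x \<in> carrier W \<Longrightarrow> len x \<le> len w\<^sub>0"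
  proof (rule obtains_MAX[OF finite_carrier])
    fix x assume "x \<in> carrier W" "Max (len ` carrier W) = len x"
    then show thesis using that[of x] finite_carrier by (metis Max_ge finite_imageI imageI)
  qed auto
  have desc: "s \<preceq>\<^sub>R w\<^sub>0" if "s \<in> S" for s
    using len_gen_mult[OF that w\<^sub>0(1)] w\<^sub>0(2)[of "s \<otimes> w\<^sub>0"] that w\<^sub>0(1)
    by (auto simp: left_descents_def simp flip: left_descents_iff_le_R)
  have "u \<preceq>\<^sub>R w\<^sub>0" if "u \<in> carrier W" for u
    using that
  proof (induction "len u" arbitrary: u)
    case 0
    then show ?case using len_eq_0[of u] w\<^sub>0(1) by auto
  next
    case (Suc n)
    then have "u \<noteq> \<one>" by auto
    then obtain s u' where "s \<in> S" "u' \<in> carrier W" "u = s \<otimes> u'" "reduced s u'"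
      using ex_first_letter Suc.prems by blast
    then show ?case
      using Suc.hyps desc by (auto intro!: lifting simp: reduced_def len_gen)
  qed
  then show ?thesis using w\<^sub>0 by blast
qed

definition longest :: 'a where
  "longest = (SOME w. w \<in> carrier W \<and> (\<forall>u \<in> carrier W. u \<preceq>\<^sub>R w))"

lemma longest: "longest \<in> carrier W" "u \<in> carrier W \<Longrightarrow> u \<preceq>\<^sub>R longest"
  using someI_ex[of "\<lambda>w. w \<in> carrier W \<and> (\<forall>u \<in> carrier W. u \<preceq>\<^sub>R w)"] ex_longest
  by (auto simp: longest_def)

text \<open>Lengths are additive below \<open>longest\<close>; applied to \<open>s\<close> and to
  \<open>s \<otimes> y\<close>, this turns both sides into
  \<open>len (s \<otimes> y) = len y + 1\<close>. Missing descents thereby become upper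
  bounds.\<close>

lemma le_R_gen_longest_iff:
  assumes "s \<in> S" "y \<in> carrier W"
  shows "y \<preceq>\<^sub>R s \<otimes> longest \<longleftrightarrow> s \<notin> left_descents W S y"
proof -
  have "len longest = len y' + len (inv y' \<otimes> longest)" if "y' \<in> carrier W" for y'
    using longest(2)[OF that] by (simp add: weak_le_R_def)
  from this[of s] this[of "s \<otimes> y"]
  have "len longest = Suc (len (s \<otimes> longest))"
    "len longest = len (s \<otimes> y) + len (inv y \<otimes> (s \<otimes> longest))"
    using assms longest(1) by (auto simp: len_gen inv_mult_group m_assoc)
  then show ?thesis
    using assms longest(1) len_gen_mult[OF assms] by (auto simp: weak_le_R_def left_descents_def)
qed

text \<open>A longest element of \<open>lift_closure J\<close> cannot be extended, so all of
  \<open>J\<close> are descents of it; \<open>lifting\<close> places it below every common upper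
  bound of \<open>J\<close>.\<close>

lemma ex_lub_gens:
  assumes "J \<subseteq> S"
  shows "\<exists>d \<in> carrier W. is_lub J d"
proof -
  have fin: "finite (lift_closure J)"
    using finite_subset[OF _ finite_carrier] lift_closure_carrier assms by blast
  obtain d where d: "d \<in> lift_closure J" "\<And>x. x \<in> lift_closure J \<Longrightarrow> len x \<le> len d"
  proof (rule obtains_MAX[OF fin])
    fix x assume "x \<in> lift_closure J" "Max (len ` lift_closure J) = len x"
    then show thesis using that[of x] fin by (metis Max_ge finite_imageI imageI)
  qed (use lift_closure.one in auto)
  have dc: "d \<in> carrier W" using d assms lift_closure_carrier by blast
  have "s \<preceq>\<^sub>R d" if "s \<in> J" for s
  proof -
    have "\<not> reduced s d"
      using d lift_closure.mult[OF d(1) that] assms that by (force simp: reduced_def len_gen)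
    then show ?thesis
      using left_descents_iff_not_reduced left_descents_iff_le_R dc assms that by blast
  qed
  then have "is_lub J d"
    using lift_closure_le_R[OF d(1) assms] le_R_trans le_R_carrier unfolding is_lub_def by blast
  then show ?thesis using dc by blast
qed

text \<open>The join of the two generators, translated by \<open>z\<close>.\<close>

lemma ex_lub_covers:
  assumes "z \<in> carrier W" "s \<in> S" "t \<in> S" "reduced z s" "reduced z t"
  shows "\<exists>c \<in> carrier W. is_lub {z \<otimes> s, z \<otimes> t} c"
proof -
  obtain d where d: "d \<in> carrier W" "is_lub {s, t} d"
    using ex_lub_gens[of "{s, t}"] assms by auto
  then have std: "s \<preceq>\<^sub>R d" "t \<preceq>\<^sub>R d" using is_lub_upper[OF d(2,1)] by auto
  have above: "reduced z d \<and> z \<otimes> d \<preceq>\<^sub>R y" if "z \<otimes> s \<preceq>\<^sub>R y" "z \<otimes> t \<preceq>\<^sub>R y" for y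
  proof -
    have zy: "z \<preceq>\<^sub>R y" using that assms le_R_mult le_R_trans gen_carrier by blast
    then have y: "y \<in> carrier W" "reduced z (inv z \<otimes> y)" by (auto simp: le_R_iff)
    have "s \<preceq>\<^sub>R inv z \<otimes> y" "t \<preceq>\<^sub>R inv z \<otimes> y"
      using that le_R_mult_iff[OF zy] assms by auto
    then have "d \<preceq>\<^sub>R inv z \<otimes> y" using y assms is_lub_le_iff[OF d(2)] by simp
    then show ?thesis
      using reduced_prefix[OF y(2)] le_R_mult_iff[OF zy] assms d by auto
  qed
  \<comment> \<open>That \<open>z\<close> and \<open>d\<close> multiply length-additively needs some
    common upper bound of the two covers; \<open>longest\<close> supplies one.\<close>
  have zd: "reduced z d" using above[of longest] longest assms by auto
  have "is_lub {z \<otimes> s, z \<otimes> t} (z \<otimes> d)"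
    unfolding is_lub_def
  proof (intro allI iffI)
    fix v assume v: "z \<otimes> d \<preceq>\<^sub>R v"
    have "z \<otimes> s \<preceq>\<^sub>R z \<otimes> d" "z \<otimes> t \<preceq>\<^sub>R z \<otimes> d"
      using std zd assms d le_R_mult_mono by auto
    then show "v \<in> carrier W \<and> (\<forall>a\<in>{z \<otimes> s, z \<otimes> t}. a \<preceq>\<^sub>R v)"
      using v le_R_trans le_R_carrier by blast
  qed (use above in auto)
  then show ?thesis using assms d by blast
qed

text \<open>
  Downward induction on the length of a common lower bound \<open>z\<close>, as for the theorem of Bjoerner,
  Edelman and Ziegler: it suffices to join the elements that cover a common element.
\<close>
lemma ex_lub_above:
  assumes "z \<preceq>\<^sub>R x" "z \<preceq>\<^sub>R y"
  shows "\<exists>j \<in> carrier W. is_lub {x, y} j"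
  using assms
proof (induction "len longest - len z" arbitrary: x y z rule: less_induct)
  case less
  have c: "z \<in> carrier W" "x \<in> carrier W" "y \<in> carrier W" using less.prems le_R_carrier by auto
  show ?case
  proof (cases "z = x \<or> z = y")
    case True
    then show ?thesis
    proof
      assume "z = x"
      then have "is_lub {x, y} y"
        using less.prems(2) le_R_trans[of x y] le_R_carrier unfolding is_lub_def by blast
      then show ?thesis using c by blast
    next
      assume "z = y"
      then have "is_lub {x, y} x"
        using less.prems(1) le_R_trans[of y x] le_R_carrier unfolding is_lub_def by blast
      then show ?thesis using c by blast
    qed
  next
    case False
    then obtain s t where s: "s \<in> S" "reduced z s" "z \<otimes> s \<preceq>\<^sub>R x"
      and t: "t \<in> S" "reduced z t" "z \<otimes> t \<preceq>\<^sub>R y"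
      using ex_cover_R less.prems by metis
    have IH: "\<exists>j \<in> carrier W. is_lub {x', y'} j"
      if "r \<in> S" "reduced z r" "z \<otimes> r \<preceq>\<^sub>R x'" "z \<otimes> r \<preceq>\<^sub>R y'" for r x' y'
    proof (rule less.hyps[OF _ that(3,4)])
      have "len (z \<otimes> r) \<le> len longest" using le_R_len longest c that by auto
      then show "len longest - len (z \<otimes> r) < len longest - len z"
        using that by (simp add: reduced_def len_gen)
    qed
    obtain j where j: "j \<in> carrier W" "is_lub {z \<otimes> s, z \<otimes> t} j"
      using ex_lub_covers c s t by blast
    then have stj: "z \<otimes> s \<preceq>\<^sub>R j" "z \<otimes> t \<preceq>\<^sub>R j" using is_lub_upper[OF j(2,1)] by auto
    \<comment> \<open>The pairs \<open>x, j\<close> and \<open>p, q\<close> share the lower bound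
      \<open>z \<otimes> s\<close>, and \<open>y, j\<close> share \<open>z \<otimes> t\<close>; both
      bounds are longer than \<open>z\<close>. Since \<open>j\<close> is below every common upper
      bound of \<open>x\<close> and \<open>y\<close>, the last join \<open>r\<close> is the join of
      \<open>x\<close> and \<open>y\<close>.\<close>
    obtain p where p: "p \<in> carrier W" "is_lub {x, j} p" using IH s stj by blast
    obtain q where q: "q \<in> carrier W" "is_lub {y, j} q" using IH t stj by blast
    have "x \<preceq>\<^sub>R p" "j \<preceq>\<^sub>R q" using is_lub_upper[OF p(2,1)] is_lub_upper[OF q(2,1)] by auto
    then have "z \<otimes> s \<preceq>\<^sub>R p" "z \<otimes> s \<preceq>\<^sub>R q" using s stj le_R_trans by blast+
    then obtain r where r: "r \<in> carrier W" "is_lub {p, q} r" using IH s by blast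
    have "j \<preceq>\<^sub>R v" if "x \<preceq>\<^sub>R v" "y \<preceq>\<^sub>R v" for v
      using is_lub_le_iff[OF j(2), of v] le_R_trans[OF s(3)] le_R_trans[OF t(3)] that le_R_carrier
      by auto
    then have "is_lub {x, y} r"
      using le_R_carrier unfolding is_lub_def is_lub_le_iff[OF r(2)]
      by (auto simp: is_lub_le_iff[OF p(2)] is_lub_le_iff[OF q(2)])
    then show ?thesis using r by blast
  qed
qed

lemma ex_lub_binary: "\<lbrakk>x \<in> carrier W; y \<in> carrier W\<rbrakk> \<Longrightarrow> \<exists>j \<in> carrier W. is_lub {x, y} j"
  using ex_lub_above[of \<one>] by simp

lemma ex_lub:
  assumes "A \<subseteq> carrier W"
  shows "\<exists>j \<in> carrier W. is_lub A j"
proof -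
  have "finite A" using assms finite_carrier finite_subset by blast
  then show ?thesis using assms
  proof (induction A rule: finite_induct)
    case empty
    then show ?case by (intro bexI[of _ \<one>]) (auto simp: is_lub_def dest: le_R_carrier)
  next
    case (insert a A)
    then obtain j where j: "j \<in> carrier W" "is_lub A j" by auto
    then obtain k where k: "k \<in> carrier W" "is_lub {a, j} k"
      using ex_lub_binary insert by (meson insert_subset)
    then have "is_lub (insert a A) k" using j by (auto simp: is_lub_def)
    then show ?case using k by blast
  qed
qed

section \<open>Descent classes as right intervals\<close>

lemma bounded_set_eq_interval_R:
  assumes "L \<subseteq> carrier W" "U \<subseteq> carrier W"
    and M: "M = {u \<in> carrier W. (\<forall>a\<in>L. a \<preceq>\<^sub>R u) \<and> (\<forall>b\<in>U. u \<preceq>\<^sub>R b)}" "M \<noteq> {}"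
  obtains p q where "p \<preceq>\<^sub>R q" "M = interval_R W S p q"
proof -
  obtain p where p: "p \<in> carrier W" "is_lub L p" using ex_lub assms by blast
  \<comment> \<open>The meet of \<open>U\<close>, obtained as the join of all its common lower
    bounds; each element of \<open>U\<close> is an upper bound of that set.\<close>
  obtain q where q: "q \<in> carrier W" "is_lub {u \<in> carrier W. \<forall>b\<in>U. u \<preceq>\<^sub>R b} q"
    using ex_lub[of "{u \<in> carrier W. \<forall>b\<in>U. u \<preceq>\<^sub>R b}"] by auto
  have low: "(\<forall>a\<in>L. a \<preceq>\<^sub>R u) \<longleftrightarrow> p \<preceq>\<^sub>R u" if "u \<in> carrier W" for u
    using is_lub_le_iff[OF p(2)] that by simp
  have "q \<preceq>\<^sub>R b" if "b \<in> U" for b using is_lub_le_iff[OF q(2)] that assms(2) by auto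
  moreover have "u \<preceq>\<^sub>R q" if "u \<in> carrier W" "\<forall>b\<in>U. u \<preceq>\<^sub>R b" for u
    using is_lub_upper[OF q(2,1)] that by simp
  ultimately have up: "(\<forall>b\<in>U. u \<preceq>\<^sub>R b) \<longleftrightarrow> u \<preceq>\<^sub>R q" if "u \<in> carrier W" for u
    using that le_R_trans by blast
  have eq: "M = interval_R W S p q"
    using low up le_R_carrier unfolding M interval_R_def by blast
  then have "p \<preceq>\<^sub>R q" using M(2) le_R_trans by (auto simp: interval_R_def)
  then show ?thesis using that eq by blast
qed

text \<open>
  If \<open>x \<otimes> u\<close> is reduced, then \<open>s\<close> is a descent of \<open>x \<otimes> u\<close> iff the join of \<open>x\<close> and \<open>s\<close> is
  below \<open>x \<otimes> u\<close>, and a non-descent iff \<open>x \<otimes> u\<close> is below \<open>s \<otimes> longest\<close>. Cancelling \<open>x\<close> turns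
  every condition on \<open>u\<close> into a lower or an upper bound.
\<close>
lemma descent_class_eq_interval_R:
  assumes w: "w \<in> carrier W" "u\<^sub>0 \<in> carrier W" "reduced w u\<^sub>0"
  obtains p q where "p \<preceq>\<^sub>R q" "descent_class w u\<^sub>0 = interval_R W S p q"
proof -
  define L where "L = {inv x \<otimes> j | x s j. x \<preceq>\<^sub>L w \<and> s \<in> left_descents W S (x \<otimes> u\<^sub>0) \<and>
    j \<in> carrier W \<and> is_lub {x, s} j}"
  \<comment> \<open>The inserted element encodes \<open>reduced w u\<close>; the others encode the
    generators that must not become descents.\<close>
  define U where "U = insert (inv w \<otimes> longest) {inv x \<otimes> (s \<otimes> longest) | x s. x \<preceq>\<^sub>L w \<and> s \<in> S \<and>
    s \<notin> left_descents W S (x \<otimes> u\<^sub>0)}"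
  have LU: "L \<subseteq> carrier W" "U \<subseteq> carrier W"
    using w longest by (auto simp: L_def U_def left_descents_def dest: le_L_carrier)
  have red: "reduced w u \<longleftrightarrow> u \<preceq>\<^sub>R inv w \<otimes> longest" if "u \<in> carrier W" for u
    using le_R_mult_iff(2)[of w longest u] longest that w reduced_prefix[of w "inv w \<otimes> longest" u]
    by (auto simp: le_R_iff)
  have low: "s \<in> left_descents W S (x \<otimes> u) \<longleftrightarrow> inv x \<otimes> j \<preceq>\<^sub>R u"
    if "u \<in> carrier W" "x \<in> carrier W" "reduced x u" "s \<in> S" "j \<in> carrier W" "is_lub {x, s} j" for u x s j
  proof -
    have "x \<preceq>\<^sub>R j" using is_lub_upper[of "{x, s}" j] that by simp
    moreover have "s \<in> left_descents W S (x \<otimes> u) \<longleftrightarrow> j \<preceq>\<^sub>R x \<otimes> u"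
      using that by (simp add: left_descents_iff_le_R is_lub_le_iff[of "{x, s}"] le_R_mult)
    ultimately show ?thesis using le_R_mult_iff(1) that by blast
  qed
  have up: "s \<notin> left_descents W S (x \<otimes> u) \<longleftrightarrow> u \<preceq>\<^sub>R inv x \<otimes> (s \<otimes> longest)"
    if "u \<in> carrier W" "x \<preceq>\<^sub>L w" "reduced w u" "s \<in> S" "s \<notin> left_descents W S (x \<otimes> u\<^sub>0)" for u x s
  proof -
    have x: "x \<in> carrier W" "reduced x u" "reduced x u\<^sub>0"
      using that w reduced_suffix le_L_carrier by blast+
    \<comment> \<open>Cancelling \<open>x\<close> requires \<open>x\<close> to lie below
      \<open>s \<otimes> longest\<close>; the given \<open>u\<^sub>0\<close> witnesses this, because
      \<open>s\<close> is not a descent of \<open>x \<otimes> u\<^sub>0\<close>.\<close>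
    have "x \<otimes> u\<^sub>0 \<preceq>\<^sub>R s \<otimes> longest" using le_R_gen_longest_iff that x w by simp
    then have "x \<preceq>\<^sub>R s \<otimes> longest" using x w le_R_mult le_R_trans by blast
    then show ?thesis using le_R_gen_longest_iff[of s "x \<otimes> u"] le_R_mult_iff(2) that x by simp
  qed
  have "descent_class w u\<^sub>0 = {u \<in> carrier W. (\<forall>a\<in>L. a \<preceq>\<^sub>R u) \<and> (\<forall>b\<in>U. u \<preceq>\<^sub>R b)}"
  proof (intro equalityI subsetI)
    fix u assume u: "u \<in> descent_class w u\<^sub>0"
    then have u': "u \<in> carrier W" "reduced w u"
      "\<And>x. x \<preceq>\<^sub>L w \<Longrightarrow> left_descents W S (x \<otimes> u) = left_descents W S (x \<otimes> u\<^sub>0)"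
      by (auto simp: descent_class_def)
    have "a \<preceq>\<^sub>R u" if a: "a \<in> L" for a
    proof -
      obtain x s j where "a = inv x \<otimes> j" "x \<preceq>\<^sub>L w" "s \<in> left_descents W S (x \<otimes> u\<^sub>0)"
        "j \<in> carrier W" "is_lub {x, s} j" using a by (auto simp: L_def)
      then show ?thesis using low[of u x s j] u' reduced_suffix[of w u x] le_L_carrier[of x w]
        by (auto simp: left_descents_def)
    qed
    moreover have "u \<preceq>\<^sub>R b" if b: "b \<in> U" for b
    proof (cases "b = inv w \<otimes> longest")
      case True
      then show ?thesis using red u' by simp
    next
      case False
      then obtain x s where "b = inv x \<otimes> (s \<otimes> longest)" "x \<preceq>\<^sub>L w" "s \<in> S"
        "s \<notin> left_descents W S (x \<otimes> u\<^sub>0)" using b by (auto simp: U_def)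
      then show ?thesis using up[of u x s] u' by simp
    qed
    ultimately show "u \<in> {u \<in> carrier W. (\<forall>a\<in>L. a \<preceq>\<^sub>R u) \<and> (\<forall>b\<in>U. u \<preceq>\<^sub>R b)}"
      using u' by blast
  next
    fix u assume "u \<in> {u \<in> carrier W. (\<forall>a\<in>L. a \<preceq>\<^sub>R u) \<and> (\<forall>b\<in>U. u \<preceq>\<^sub>R b)}"
    then have u: "u \<in> carrier W" "\<And>a. a \<in> L \<Longrightarrow> a \<preceq>\<^sub>R u" "\<And>b. b \<in> U \<Longrightarrow> u \<preceq>\<^sub>R b" by auto
    have wu: "reduced w u" using u red by (simp add: U_def)
    have "s \<in> left_descents W S (x \<otimes> u) \<longleftrightarrow> s \<in> left_descents W S (x \<otimes> u\<^sub>0)"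
      if x: "x \<preceq>\<^sub>L w" and s: "s \<in> S" for x s
    proof (cases "s \<in> left_descents W S (x \<otimes> u\<^sub>0)")
      case True
      have xc: "x \<in> carrier W" using x le_L_carrier by blast
      then obtain j where j: "j \<in> carrier W" "is_lub {x, s} j"
        using ex_lub_binary[OF xc gen_carrier[OF s]] by blast
      then have "inv x \<otimes> j \<in> L" using x True by (auto simp: L_def)
      then show ?thesis using low[of u x s j] u j s xc True reduced_suffix[OF wu x] by simp
    next
      case False
      then have "inv x \<otimes> (s \<otimes> longest) \<in> U" using x s by (auto simp: U_def)
      then show ?thesis using up[of u x s] u x s wu False by blast
    qed
    then have "left_descents W S (x \<otimes> u) = left_descents W S (x \<otimes> u\<^sub>0)" if "x \<preceq>\<^sub>L w" for x
      using that by (auto simp: left_descents_def)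
    then show "u \<in> descent_class w u\<^sub>0" using u wu by (simp add: descent_class_def)
  qed
  moreover have "descent_class w u\<^sub>0 \<noteq> {}" using w by (auto simp: descent_class_def)
  ultimately obtain p q where "p \<preceq>\<^sub>R q" "descent_class w u\<^sub>0 = interval_R W S p q"
    by (rule bounded_set_eq_interval_R[OF LU])
  then show ?thesis by (rule that)
qed

end

theorem theorem5p7:
  fixes W :: "('a, 'b) monoid_scheme" and S :: "'a set" and C :: "'a set set"
  assumes "coxeter_system W S"
    and "finite (carrier W)"
    and "C \<in> left_intervals W S // descent_equiv W S"
  shows "min_elems W S C \<in> right_intervals W S \<and> max_elems W S C \<in> right_intervals W S"
proof -
  interpret coxeter_system W S by fact
  interpret finite_coxeter_system W S by unfold_locales fact
  obtain I where I: "I \<in> left_intervals W S" "C = descent_equiv W S `` {I}"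
    using assms(3) by (rule quotientE)
  then obtain u\<^sub>0 v\<^sub>0 where uv: "u\<^sub>0 \<preceq>\<^sub>L v\<^sub>0" "I = interval_L W S u\<^sub>0 v\<^sub>0"
    by (auto simp: left_intervals_def)
  from uv(1) obtain w where w: "w \<in> carrier W" "v\<^sub>0 = w \<otimes>\<^bsub>W\<^esub> u\<^sub>0" "reduced w u\<^sub>0"
    by (rule le_L_decomp)
  have u\<^sub>0: "u\<^sub>0 \<in> carrier W" using uv le_L_carrier by blast
  obtain p q where pq: "p \<preceq>\<^sub>R q" "descent_class w u\<^sub>0 = interval_R W S p q"
    using w(1) u\<^sub>0 w(3) by (rule descent_class_eq_interval_R)
  have c: "p \<in> carrier W" "q \<in> carrier W" using pq le_R_carrier by auto
  \<comment> \<open>The top \<open>q\<close> is itself an admissible minimum, so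
    \<open>w \<otimes> q\<close> is reduced and \<open>interval_R_mult\<close> can translate the
    whole interval by \<open>w\<close>.\<close>
  have "q \<in> descent_class w u\<^sub>0" using pq c by (simp add: interval_R_def)
  then have wq: "reduced w q" by (simp add: descent_class_def)
  have "w \<otimes>\<^bsub>W\<^esub> p \<preceq>\<^sub>R w \<otimes>\<^bsub>W\<^esub> q"
    using le_R_mult_mono[of w p q] reduced_prefix[OF wq pq(1)] w c wq pq(1) by simp
  moreover have C: "C = descent_equiv W S `` {interval_L W S u\<^sub>0 (w \<otimes>\<^bsub>W\<^esub> u\<^sub>0)}"
    using I(2) uv(2) w(2) by simp
  have "min_elems W S C = interval_R W S p q"
    using min_max_elems_eq(1)[OF w(1) u\<^sub>0 w(3) C] pq(2) by simp
  moreover have "max_elems W S C = interval_R W S (w \<otimes>\<^bsub>W\<^esub> p) (w \<otimes>\<^bsub>W\<^esub> q)"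
    using min_max_elems_eq(2)[OF w(1) u\<^sub>0 w(3) C] pq(2) interval_R_mult[OF w(1) pq(1) wq] by simp
  ultimately show ?thesis
    using pq(1) unfolding right_intervals_def by blast
qed

end
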